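(* Consider a cover of the $1$-skeleton of $\Omega$ with three closed convex sets $C_1,C_2,C_3$. Assume moreover that we are given a point $t_f$ in each two-dimensional face $f$ in $F(C_1,C_2,C_3)$. Then the sets $\operatorname{conv}\bigl(C_i\cup\{t_f: f\in F(C_1,C_2,C_3)\}\bigr)$, for $i=1,2,3$, form a cover of $\Omega$.
   Context: $\Omega$ is a polytope of $\mathbb{R}^n$, and its $1$-skeleton is formed by its vertices and edges. For a cover of the $1$-skeleton of $\Omega$ with three non-empty closed convex sets $C_1,C_2,C_3$, $F(C_1,C_2,C_3)$ is defined as the set of two-dimensional faces of $\Omega$ such that the $C_i$'s are pairwise intersecting on the boundary of the face (i.e. $C_i\cap C_j$ contains a point of the boundary of the face for all $i\neq j$). If $\Omega$ is two-dimensional, $\Omega$ itself counts as a two-dimensional face. $\operatorname{conv}$ denotes the convex hull. Sets are said to form a cover of a set if their union contains it. *)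

theory Defs
  imports "HOL-Analysis.Analysis"
begin

(* A set is a face of itself under face_of, so a one-dimensional polytope is its own edge and
   a two-dimensional polytope is its own two-dimensional face. *)

definition one_skeleton :: "'a::euclidean_space set \<Rightarrow> 'a set" where
  "one_skeleton \<Omega> = {v. v extreme_point_of \<Omega>} \<union> \<Union> {e. e edge_of \<Omega>}"

(* The boundary of a face is taken relative to its affine hull, hence rel_frontier.
   Different pairs of sets may meet at different boundary points. *)

definition intersecting_faces ::
  "'a::euclidean_space set \<Rightarrow> 'a set \<Rightarrow> 'a set \<Rightarrow> 'a set \<Rightarrow> 'a set set" where
  "intersecting_faces \<Omega> C1 C2 C3 =
     {f. f face_of \<Omega> \<and> aff_dim f = 2 \<and>
         C1 \<inter> C2 \<inter> rel_frontier f \<noteq> {} \<and>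
         C1 \<inter> C3 \<inter> rel_frontier f \<noteq> {} \<and>
         C2 \<inter> C3 \<inter> rel_frontier f \<noteq> {}}"

end

theory Submission
  imports Defs
begin

text \<open>If \<open>x\<close> lies in none of the hulls, separate it from each of them: \<open>a\<^sub>i \<bullet> y < a\<^sub>i \<bullet> x\<close> on the \<open>i\<close>-th
  hull. Take a face \<open>f\<close> minimal among those meeting \<open>K = {y. \<forall>i. a\<^sub>i \<bullet> x \<le> a\<^sub>i \<bullet> y}\<close>. Then \<open>K\<close> misses the
  relative boundary of \<open>f\<close>, so no nonzero direction \<open>v\<close> of \<open>f\<close> has all \<open>a\<^sub>i \<bullet> v \<ge> 0\<close>, which forces
  \<open>dim f \<le> 2\<close>; and \<open>dim f \<ge> 2\<close> since \<open>K\<close> misses the 1-skeleton. On the boundary circle of \<open>f\<close> the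
  three sets meet pairwise by connectedness of arcs, so \<open>t f\<close> is one of the given points; but then the direction from
  \<open>t f\<close> to a point of \<open>K \<inter> f\<close> has all \<open>a\<^sub>i \<bullet> v > 0\<close>.\<close>

section \<open>Affine dimension, directions and rays\<close>

lemma aff_dim_affine_Int_hyperplane_through:
  fixes q :: "'a::euclidean_space"
  assumes "affine S" "q \<in> S"
  shows "aff_dim S - 1 \<le> aff_dim (S \<inter> {y. a \<bullet> y = a \<bullet> q})"
proof -
  \<comment> \<open>Only an empty intersection could lower the dimension by more than one.\<close>
  have "q \<in> S \<inter> {y. a \<bullet> y = a \<bullet> q}"
    using assms by simp
  then show ?thesis
    by (subst aff_dim_affine_Int_hyperplane[OF assms(1)]) auto
qed

lemma affine_direction_exists:
  fixes q :: "'a::euclidean_space"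
  assumes "q \<in> S" "aff_dim S \<ge> 1"
  obtains v where "v \<noteq> 0" "q + v \<in> S"
proof -
  have "S \<noteq> {q}"
    using assms(2) by auto
  then obtain p where "p \<in> S" "p \<noteq> q"
    using assms(1) by blast
  then show thesis
    using that[of "p - q"] by simp
qed

text \<open>The nearer of two such points would lie strictly between \<open>q\<close> and a point of
  the closure, hence in the relative interior.\<close>

lemma rel_frontier_ray_unique:
  fixes q :: "'a::euclidean_space"
  assumes "convex S" "q \<in> rel_interior S" "d \<noteq> 0"
    and "0 \<le> \<mu>" "q + \<mu> *\<^sub>R d \<in> rel_frontier S"
    and "0 \<le> \<nu>" "q + \<nu> *\<^sub>R d \<in> rel_frontier S"
  shows "\<mu> = \<nu>"
proof -
  have no: False
    if "0 \<le> s" "s < r" "q + s *\<^sub>R d \<in> rel_frontier S" "q + r *\<^sub>R d \<in> rel_frontier S" for s r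
  proof -
    have "s \<noteq> 0"
      using that(3) assms(2) by (auto simp: rel_frontier_def)
    have "q + s *\<^sub>R d = (1 - s / r) *\<^sub>R q + (s / r) *\<^sub>R (q + r *\<^sub>R d)"
      using that by (simp add: algebra_simps)
    moreover have "0 < s / r" "s / r < 1"
      using that \<open>s \<noteq> 0\<close> by auto
    moreover have "q \<noteq> q + r *\<^sub>R d"
      using that assms(3) by simp
    ultimately have "q + s *\<^sub>R d \<in> open_segment q (q + r *\<^sub>R d)"
      unfolding in_segment by blast
    moreover have "open_segment q (q + r *\<^sub>R d) \<subseteq> rel_interior S"
      using rel_interior_closure_convex_segment[OF assms(1,2)] that(4)
      by (auto simp: rel_frontier_def)
    ultimately show False
      using that(3) by (auto simp: rel_frontier_def)
  qed
  show ?thesis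
    using no[of \<mu> \<nu>] no[of \<nu> \<mu>] assms(4-7) by (meson linorder_neqE_linordered_idom)
qed

text \<open>Since \<open>c\<close> is 1 on \<open>Q\<close>, the parameter \<mu> equals the increase
  of \<open>c\<close> from \<open>q\<close> to the point of \<open>P\<close>, so it is bounded. The
  set is therefore the projection of a compact set of pairs.\<close>

lemma closed_ray_directions:
  fixes q :: "'a::euclidean_space"
  assumes "compact P" "compact Q" and pos: "\<And>d. d \<in> Q \<Longrightarrow> c \<bullet> d = 1"
  shows "closed {d \<in> Q. \<exists>\<mu>\<ge>0. q + \<mu> *\<^sub>R d \<in> P}"
proof -
  have "bounded ((\<lambda>y. c \<bullet> (y - q)) ` P)"
    by (intro compact_imp_bounded compact_continuous_image continuous_intros assms)
  then obtain M where M: "\<And>y. y \<in> P \<Longrightarrow> \<bar>c \<bullet> (y - q)\<bar> \<le> M"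
    unfolding bounded_real by auto
  let ?g = "\<lambda>(d, \<mu>). q + \<mu> *\<^sub>R d"
  have "compact ((Q \<times> {0..M}) \<inter> ?g -` P)"
  proof (rule compact_Int_closed)
    show "compact (Q \<times> {0..M})"
      by (intro compact_Times assms compact_Icc)
    have "continuous_on UNIV ?g"
      unfolding case_prod_unfold by (intro continuous_intros)
    then show "closed (?g -` P)"
      using closed_vimage[OF compact_imp_closed[OF assms(1)]] by blast
  qed
  then have "closed (fst ` ((Q \<times> {0..M}) \<inter> ?g -` P))"
    by (intro compact_imp_closed compact_continuous_image continuous_intros)
  moreover have "fst ` ((Q \<times> {0..M}) \<inter> ?g -` P) = {d \<in> Q. \<exists>\<mu>\<ge>0. q + \<mu> *\<^sub>R d \<in> P}"
  proof (intro equalityI subsetI)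
    fix d assume "d \<in> {d \<in> Q. \<exists>\<mu>\<ge>0. q + \<mu> *\<^sub>R d \<in> P}"
    then obtain \<mu> where d: "d \<in> Q" "\<mu> \<ge> 0" "q + \<mu> *\<^sub>R d \<in> P"
      by blast
    then have "\<mu> \<le> M"
      using M[OF d(3)] pos[OF d(1)] by simp
    then have "(d, \<mu>) \<in> (Q \<times> {0..M}) \<inter> ?g -` P"
      using d by simp
    then show "d \<in> fst ` ((Q \<times> {0..M}) \<inter> ?g -` P)"
      by force
  qed auto
  ultimately show ?thesis
    by simp
qed

section \<open>Directions in an affine hull, and the cover on a relative boundary\<close>

lemma affine_add_scaleR:
  fixes q :: "'a::real_vector"
  assumes "affine S" "q \<in> S" "q + v \<in> S"
  shows "q + r *\<^sub>R v \<in> S"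
proof -
  have "(1 - r) *\<^sub>R q + r *\<^sub>R (q + v) \<in> S"
    using assms by (intro mem_affine) auto
  then show ?thesis
    by (simp add: algebra_simps)
qed

text \<open>Some nonzero direction \<open>v\<close> is annihilated by \<open>b\<close>. If
  \<open>c\<close> vanished on it too, \<open>dir\<close> for \<open>v\<close> and
  \<open>- v\<close> would make \<open>a\<close> negative on both. Hence \<open>v\<close> can be
  rescaled, with its sign, to give \<open>c\<close> the value 1.\<close>

lemma normalized_direction:
  fixes q :: "'a::euclidean_space"
  assumes "aff_dim f \<ge> 2" "q \<in> affine hull f"
    and dir: "\<And>v. \<lbrakk>v \<noteq> 0; q + v \<in> affine hull f\<rbrakk> \<Longrightarrow> a \<bullet> v < 0 \<or> b \<bullet> v < 0 \<or> c \<bullet> v < 0"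
  obtains d where "q + d \<in> affine hull f" "b \<bullet> d = 0" "c \<bullet> d = 1"
proof -
  let ?A = "affine hull f"
  have "aff_dim (?A \<inter> {y. b \<bullet> y = b \<bullet> q}) \<ge> 1"
    using aff_dim_affine_Int_hyperplane_through[of ?A q b] assms by simp
  then obtain v where v: "v \<noteq> 0" "q + v \<in> ?A" "b \<bullet> v = 0"
    using affine_direction_exists[of q "?A \<inter> {y. b \<bullet> y = b \<bullet> q}"] assms(2)
    by (auto simp: inner_add_right)
  have "q + (-1) *\<^sub>R v \<in> ?A"
    using v assms(2) by (intro affine_add_scaleR) auto
  then have "c \<bullet> v \<noteq> 0"
    using dir[of v] dir[of "- v"] v by auto
  moreover have "q + (1 / (c \<bullet> v)) *\<^sub>R v \<in> ?A"
    using v assms(2) by (intro affine_add_scaleR) auto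
  ultimately show thesis
    using that[of "(1 / (c \<bullet> v)) *\<^sub>R v"] v by simp
qed

text \<open>The boundary points seen from \<open>q\<close> in the directions of a segment on which \<open>c\<close> is positive
  form an arc avoiding \<open>C3\<close>, with one end outside \<open>C2\<close> and the other outside \<open>C1\<close>. Its
  connectedness makes \<open>C1\<close> and \<open>C2\<close> meet on it.\<close>

lemma rel_frontier_cover_intersects:
  fixes f :: "'a::euclidean_space set"
  assumes "compact f" "convex f" "aff_dim f \<ge> 2"
    and q: "q \<in> rel_interior f" "a \<bullet> q \<ge> \<alpha>" "b \<bullet> q \<ge> \<beta>" "c \<bullet> q \<ge> \<gamma>"
    and dir: "\<And>v. \<lbrakk>v \<noteq> 0; q + v \<in> affine hull f\<rbrakk> \<Longrightarrow> a \<bullet> v < 0 \<or> b \<bullet> v < 0 \<or> c \<bullet> v < 0"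
    and "closed C1" "closed C2"
    and cover: "rel_frontier f \<subseteq> C1 \<union> C2 \<union> C3"
    and C1: "\<And>y. y \<in> C1 \<inter> rel_frontier f \<Longrightarrow> a \<bullet> y < \<alpha>"
    and C2: "\<And>y. y \<in> C2 \<inter> rel_frontier f \<Longrightarrow> b \<bullet> y < \<beta>"
    and C3: "\<And>y. y \<in> C3 \<inter> rel_frontier f \<Longrightarrow> c \<bullet> y < \<gamma>"
  shows "C1 \<inter> C2 \<inter> rel_frontier f \<noteq> {}"
proof
  assume disj: "C1 \<inter> C2 \<inter> rel_frontier f = {}"
  have qA: "q \<in> affine hull f"
    using rel_interior_subset[THEN subsetD, OF q(1)] by (rule hull_inc)
  \<comment> \<open>Along the ray of \<open>d1\<close> the value of \<open>b\<close> stays at least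
    \<beta>, so its boundary point is outside \<open>C2\<close>; likewise \<open>d2\<close> with
    \<open>a\<close> and \<open>C1\<close>.\<close>
  obtain d1 where d1: "q + d1 \<in> affine hull f" "b \<bullet> d1 = 0" "c \<bullet> d1 = 1"
    by (rule normalized_direction[OF assms(3) qA, of a b c]) (use dir in auto)
  obtain d2 where d2: "q + d2 \<in> affine hull f" "a \<bullet> d2 = 0" "c \<bullet> d2 = 1"
    by (rule normalized_direction[OF assms(3) qA, of b a c]) (use dir in auto)
  define Q where "Q = closed_segment d1 d2"
  have cQ: "c \<bullet> d = 1" if "d \<in> Q" for d
    using that d1 d2 unfolding Q_def in_segment by (auto simp: inner_add_right)
  have qQ: "q + d \<in> affine hull f" if d: "d \<in> Q" for d
  proof -
    obtain u where "d = (1 - u) *\<^sub>R d1 + u *\<^sub>R d2"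
      using d unfolding Q_def in_segment by blast
    then have "q + d = (1 - u) *\<^sub>R (q + d1) + u *\<^sub>R (q + d2)"
      by (simp add: algebra_simps)
    then show ?thesis
      using d1 d2 by (simp add: mem_affine)
  qed
  have ray: "\<exists>\<mu>>0. q + \<mu> *\<^sub>R d \<in> rel_frontier f" if "d \<in> Q" for d
    using ray_to_rel_frontier[OF compact_imp_bounded[OF assms(1)] q(1) qQ[OF that]] cQ[OF that]
    by (metis inner_zero_right zero_neq_one)
  \<comment> \<open>The arc is represented by its directions: closedness of these sets and
    connectedness of the segment \<open>Q\<close> replace continuity of the radial
    projection.\<close>
  define D where "D C = {d \<in> Q. \<exists>\<mu>\<ge>0. q + \<mu> *\<^sub>R d \<in> rel_frontier f \<inter> C}" for C
  have cl: "closed (D C)" if "closed C" for C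
    unfolding D_def
  proof (rule closed_ray_directions)
    show "compact (rel_frontier f \<inter> C)"
      using that compact_rel_frontier_bounded[OF compact_imp_bounded[OF assms(1)]]
      by (rule compact_Int_closed[rotated])
    show "compact Q"
      unfolding Q_def by (rule compact_segment)
  qed (rule cQ)
  have "Q \<subseteq> D C1 \<union> D C2"
  proof
    fix d assume d: "d \<in> Q"
    then obtain \<mu> where \<mu>: "\<mu> > 0" "q + \<mu> *\<^sub>R d \<in> rel_frontier f"
      using ray by blast
    \<comment> \<open>\<open>c\<close> increases along the ray from a value at least \<gamma>, which
      rules out \<open>C3\<close>.\<close>
    then have "c \<bullet> (q + \<mu> *\<^sub>R d) \<ge> \<gamma>"
      using q(4) cQ[OF d] by (simp add: inner_add_right)
    then have "q + \<mu> *\<^sub>R d \<in> C1 \<union> C2"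
      using cover C3 \<mu>(2) by fastforce
    then show "d \<in> D C1 \<union> D C2"
      unfolding D_def using d \<mu> by (auto intro!: exI[of _ \<mu>])
  qed
  moreover have "D C1 \<inter> D C2 = {}"
  proof (rule ccontr)
    assume "D C1 \<inter> D C2 \<noteq> {}"
    then obtain d \<mu> \<nu> where d: "d \<in> Q" and \<mu>: "\<mu> \<ge> 0" "q + \<mu> *\<^sub>R d \<in> rel_frontier f \<inter> C1"
      and \<nu>: "\<nu> \<ge> 0" "q + \<nu> *\<^sub>R d \<in> rel_frontier f \<inter> C2"
      unfolding D_def by blast
    have "d \<noteq> 0"
      using cQ[OF d] by auto
    then have "\<mu> = \<nu>"
      using \<mu> \<nu> by (intro rel_frontier_ray_unique[OF assms(2) q(1)]) auto
    then show False
      using \<mu> \<nu> disj by blast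
  qed
  moreover have "d1 \<in> Q" "d2 \<in> Q"
    unfolding Q_def by auto
  moreover have "d1 \<notin> D C2"
    using C2 d1(2) q(3) unfolding D_def by (force simp: inner_add_right)
  moreover have "d2 \<notin> D C1"
    using C1 d2(2) q(2) unfolding D_def by (force simp: inner_add_right)
  moreover have "connected Q"
    unfolding Q_def by (rule connected_segment)
  ultimately show False
    using connected_closed[of Q] cl[OF \<open>closed C1\<close>] cl[OF \<open>closed C2\<close>] by blast
qed

section \<open>Faces inside the 1-skeleton, and separation from the hulls\<close>

lemma rel_frontier_subset_one_skeleton:
  assumes "polytope \<Omega>" "f face_of \<Omega>" "aff_dim f = 2"
  shows "rel_frontier f \<subseteq> one_skeleton \<Omega>"
proof
  fix y assume "y \<in> rel_frontier f"
  moreover have "polyhedron f"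
    using assms face_of_polytope_polytope polytope_imp_polyhedron by blast
  ultimately obtain e where e: "e facet_of f" "y \<in> e"
    using rel_frontier_of_polyhedron by blast
  then have "e edge_of \<Omega>"
    using assms by (auto simp: edge_of_def facet_of_def intro: face_of_trans)
  then show "y \<in> one_skeleton \<Omega>"
    unfolding one_skeleton_def using e(2) by blast
qed

lemma face_low_dim_subset_one_skeleton:
  assumes "f face_of \<Omega>" "aff_dim f \<le> 1"
  shows "f \<subseteq> one_skeleton \<Omega>"
proof -
  consider "aff_dim f = -1" | "aff_dim f = 0" | "aff_dim f = 1"
    using assms(2) aff_dim_geq[of f] by linarith
  then show ?thesis
  proof cases
    case 1
    then have "f = {}"
      using aff_dim_empty by blast
    then show ?thesis
      by simp
  next
    case 2
    then obtain v where "f = {v}"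
      using aff_dim_eq_0 by blast
    then show ?thesis
      using assms(1) unfolding one_skeleton_def by (simp add: face_of_singleton)
  next
    case 3
    then show ?thesis
      using assms(1) unfolding one_skeleton_def edge_of_def by blast
  qed
qed

lemma one_skeleton_subset: "one_skeleton \<Omega> \<subseteq> \<Omega>"
  unfolding one_skeleton_def edge_of_def extreme_point_of_def using face_of_imp_subset by blast

text \<open>The hull of \<open>C \<union> T\<close> need not be closed. Cutting \<open>C\<close>
  down to the compact \<Omega> gives a compact hull that still misses \<open>x\<close>.\<close>

lemma strict_separation_of_hull:
  fixes x :: "'a::euclidean_space"
  assumes "compact \<Omega>" "closed C" "finite T" "x \<notin> convex hull (C \<union> T)"
  obtains a where "\<And>y. y \<in> C \<inter> \<Omega> \<union> T \<Longrightarrow> a \<bullet> y < a \<bullet> x"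
proof -
  let ?H = "convex hull (C \<inter> \<Omega> \<union> T)"
  have "compact ?H"
    using closed_Int_compact[OF assms(2,1)] finite_imp_compact[OF assms(3)]
    by (intro compact_convex_hull compact_Un)
  moreover have "x \<notin> ?H"
    using assms(4) hull_mono[of "C \<inter> \<Omega> \<union> T" "C \<union> T" convex] by blast
  ultimately obtain a b where "a \<bullet> x < b" "\<forall>y\<in>?H. a \<bullet> y > b"
    using separating_hyperplane_closed_point[of ?H x] compact_imp_closed by auto
  then have "(- a) \<bullet> y < (- a) \<bullet> x" if "y \<in> C \<inter> \<Omega> \<union> T" for y
    using hull_inc[OF that, of convex] by fastforce
  then show thesis
    using that by blast
qed

section \<open>Covering the polytope by the three hulls\<close>

theorem lemma3p5:
  fixes \<Omega> C1 C2 C3 :: "'a::euclidean_space set" and t :: "'a set \<Rightarrow> 'a"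
  assumes "polytope \<Omega>"
    and "closed C1" "convex C1"
    and "closed C2" "convex C2"
    and "closed C3" "convex C3"
    and "one_skeleton \<Omega> \<subseteq> C1 \<union> C2 \<union> C3"
    and "\<And>f. f \<in> intersecting_faces \<Omega> C1 C2 C3 \<Longrightarrow> t f \<in> f"
  shows "\<Omega> \<subseteq>
      convex hull (C1 \<union> t ` intersecting_faces \<Omega> C1 C2 C3) \<union>
      convex hull (C2 \<union> t ` intersecting_faces \<Omega> C1 C2 C3) \<union>
      convex hull (C3 \<union> t ` intersecting_faces \<Omega> C1 C2 C3)"
proof (rule ccontr)
  let ?F = "intersecting_faces \<Omega> C1 C2 C3"
  assume "\<not> ?thesis"
  then obtain x where x: "x \<in> \<Omega>" "x \<notin> convex hull (C1 \<union> t ` ?F)"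
      "x \<notin> convex hull (C2 \<union> t ` ?F)" "x \<notin> convex hull (C3 \<union> t ` ?F)"
    by blast
  have finF: "finite (t ` ?F)"
    using finite_polytope_faces[OF assms(1)]
    by (intro finite_imageI) (rule finite_subset, auto simp: intersecting_faces_def)
  note sep = strict_separation_of_hull[OF polytope_imp_compact[OF assms(1)] _ finF]
  obtain a1 where a1: "\<And>y. y \<in> C1 \<inter> \<Omega> \<union> t ` ?F \<Longrightarrow> a1 \<bullet> y < a1 \<bullet> x"
    using sep[OF assms(2) x(2)] by blast
  obtain a2 where a2: "\<And>y. y \<in> C2 \<inter> \<Omega> \<union> t ` ?F \<Longrightarrow> a2 \<bullet> y < a2 \<bullet> x"
    using sep[OF assms(4) x(3)] by blast
  obtain a3 where a3: "\<And>y. y \<in> C3 \<inter> \<Omega> \<union> t ` ?F \<Longrightarrow> a3 \<bullet> y < a3 \<bullet> x"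
    using sep[OF assms(6) x(4)] by blast
  define K where "K = {y. a1 \<bullet> x \<le> a1 \<bullet> y \<and> a2 \<bullet> x \<le> a2 \<bullet> y \<and> a3 \<bullet> x \<le> a3 \<bullet> y}"
  \<comment> \<open>A point of \<Omega> in one of the three sets violates the corresponding
    inequality of \<open>K\<close>.\<close>
  have skelK: "one_skeleton \<Omega> \<inter> K = {}"
    using assms(8) a1 a2 a3 one_skeleton_subset[of \<Omega>] unfolding K_def by fastforce
  define \<G> where "\<G> = {G. G face_of \<Omega> \<and> G \<inter> K \<noteq> {}}"
  have "\<Omega> \<in> \<G>"
    using x(1) face_of_refl[OF polytope_imp_convex[OF assms(1)]] unfolding \<G>_def K_def by auto
  moreover have "finite \<G>"
    using finite_polytope_faces[OF assms(1)] unfolding \<G>_def by (rule rev_finite_subset) auto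
  ultimately obtain f where f: "f \<in> \<G>" and min: "\<And>G. G \<in> \<G> \<Longrightarrow> G \<subseteq> f \<Longrightarrow> f = G"
    using finite_has_minimal[of \<G>] by blast
  have face: "f face_of \<Omega>"
    using f unfolding \<G>_def by blast
  have poly: "polytope f"
    using face_of_polytope_polytope[OF assms(1) face] .
  obtain q where q: "q \<in> f" "q \<in> K"
    using f unfolding \<G>_def by blast
  \<comment> \<open>The relative boundary is the union of the facets, which are smaller faces of
    \<Omega> and so miss \<open>K\<close> by minimality.\<close>
  have frK: "rel_frontier f \<inter> K = {}"
  proof -
    have "g \<inter> K = {}" if g: "g facet_of f" for g
    proof (rule ccontr)
      assume "g \<inter> K \<noteq> {}"
      then have "g \<in> \<G>"
        using facet_of_imp_face_of[OF g] face unfolding \<G>_def by (auto intro: face_of_trans)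
      then have "f = g"
        using min facet_of_imp_subset[OF g] by blast
      then show False
        using g by simp
    qed
    then show ?thesis
      using rel_frontier_of_polyhedron[OF polytope_imp_polyhedron[OF poly]] by blast
  qed
  have qi: "q \<in> rel_interior f"
    using q frK closure_subset unfolding rel_frontier_def by blast
  have qA: "q \<in> affine hull f"
    using q(1) by (rule hull_inc)
  \<comment> \<open>Otherwise the ray from \<open>q\<close> along \<open>v\<close> would stay in
    \<open>K\<close> until it reached the relative boundary.\<close>
  have dir: "a1 \<bullet> v < 0 \<or> a2 \<bullet> v < 0 \<or> a3 \<bullet> v < 0" if v: "v \<noteq> 0" "q + v \<in> affine hull f" for v
  proof (rule ccontr)
    assume neg: "\<not> ?thesis"
    obtain d where d: "0 < d" "q + d *\<^sub>R v \<in> rel_frontier f"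
      using ray_to_rel_frontier[OF polytope_imp_bounded[OF poly] qi v(2) v(1)] by blast
    have "0 \<le> d * (a1 \<bullet> v)" "0 \<le> d * (a2 \<bullet> v)" "0 \<le> d * (a3 \<bullet> v)"
      using neg d(1) by auto
    then have "q + d *\<^sub>R v \<in> K"
      using q(2) unfolding K_def by (simp add: inner_add_right)
    then show False
      using d(2) frK by blast
  qed
  have "aff_dim f \<ge> 2"
    using face_low_dim_subset_one_skeleton[OF face] skelK q by fastforce
  moreover have "aff_dim f \<le> 2"
  proof (rule ccontr)
    assume "\<not> ?thesis"
    \<comment> \<open>In dimension at least 3, two hyperplanes leave a direction on which
      \<open>a1\<close> and \<open>a2\<close> vanish; it or its opposite has a nonnegative value
      under \<open>a3\<close>.\<close>
    then have "aff_dim (affine hull f \<inter> {y. a1 \<bullet> y = a1 \<bullet> q}) \<ge> 2"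
      using aff_dim_affine_Int_hyperplane_through[of "affine hull f" q a1] qA by simp
    moreover have "affine (affine hull f \<inter> {y. a1 \<bullet> y = a1 \<bullet> q})"
      by (intro affine_Int affine_affine_hull affine_hyperplane)
    ultimately have
      "aff_dim (affine hull f \<inter> {y. a1 \<bullet> y = a1 \<bullet> q} \<inter> {y. a2 \<bullet> y = a2 \<bullet> q}) \<ge> 1"
      using aff_dim_affine_Int_hyperplane_through[of _ q a2] qA by fastforce
    then obtain v where v: "v \<noteq> 0" "q + v \<in> affine hull f" "a1 \<bullet> v = 0" "a2 \<bullet> v = 0"
      using affine_direction_exists[of q
          "affine hull f \<inter> {y. a1 \<bullet> y = a1 \<bullet> q} \<inter> {y. a2 \<bullet> y = a2 \<bullet> q}"] qA
      by (auto simp: inner_add_right)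
    have "q + (-1) *\<^sub>R v \<in> affine hull f"
      using v qA by (intro affine_add_scaleR) auto
    then show False
      using dir[of v] dir[of "- v"] v by auto
  qed
  ultimately have dim: "aff_dim f = 2"
    by simp
  have fr: "rel_frontier f \<subseteq> one_skeleton \<Omega>"
    using rel_frontier_subset_one_skeleton[OF assms(1) face dim] .
  have cover: "rel_frontier f \<subseteq> C1 \<union> C2 \<union> C3"
    using fr assms(8) by blast
  have neg: "y \<in> C1 \<inter> rel_frontier f \<Longrightarrow> a1 \<bullet> y < a1 \<bullet> x"
    "y \<in> C2 \<inter> rel_frontier f \<Longrightarrow> a2 \<bullet> y < a2 \<bullet> x"
    "y \<in> C3 \<inter> rel_frontier f \<Longrightarrow> a3 \<bullet> y < a3 \<bullet> x" for y
    using a1 a2 a3 fr one_skeleton_subset[of \<Omega>] by blast+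
  have qK: "a1 \<bullet> q \<ge> a1 \<bullet> x" "a2 \<bullet> q \<ge> a2 \<bullet> x" "a3 \<bullet> q \<ge> a3 \<bullet> x"
    using q(2) unfolding K_def by auto
  \<comment> \<open>Used for each pair, with the functionals permuted so that the last one belongs
    to the remaining set.\<close>
  note meet = rel_frontier_cover_intersects[OF polytope_imp_compact[OF poly]
      polytope_imp_convex[OF poly] eq_refl[OF dim[symmetric]] qi]
  have "C1 \<inter> C2 \<inter> rel_frontier f \<noteq> {}"
    using cover by (intro meet[OF qK(1,2,3) _ assms(2,4) _ neg(1,2,3)]) (drule (1) dir, argo, auto)
  moreover have "C1 \<inter> C3 \<inter> rel_frontier f \<noteq> {}"
    using cover by (intro meet[OF qK(1,3,2) _ assms(2,6) _ neg(1,3,2)]) (drule (1) dir, argo, auto)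
  moreover have "C2 \<inter> C3 \<inter> rel_frontier f \<noteq> {}"
    using cover by (intro meet[OF qK(2,3,1) _ assms(4,6) _ neg(2,3,1)]) (drule (1) dir, argo, auto)
  ultimately have fF: "f \<in> ?F"
    unfolding intersecting_faces_def using face dim by blast
  then have "t f \<in> affine hull f"
    using assms(9) by (simp add: hull_inc)
  \<comment> \<open>Reflecting \<open>t f\<close> in \<open>q\<close> makes \<open>q - t f\<close> a
    direction based at \<open>q\<close>. The strict inequalities below also show that it is
    nonzero.\<close>
  then have "q + (-1) *\<^sub>R (t f - q) \<in> affine hull f"
    using qA by (intro affine_add_scaleR) auto
  moreover have "a1 \<bullet> (t f) < a1 \<bullet> x" "a2 \<bullet> (t f) < a2 \<bullet> x" "a3 \<bullet> (t f) < a3 \<bullet> x"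
    using a1 a2 a3 fF by blast+
  ultimately show False
    using dir[of "q - t f"] qK by (force simp: inner_diff_right)
qed

end
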